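(* Consider a stationary Lax-type shock in the $x_1$ direction, noncharacteristic (i.e. $\det A_1^\pm\ne0$) and with $|\bar h|^2\neq\bar\rho\,p'(\bar\rho)$ at both endstates, of either the MHD $\beta$-model with $\beta\neq0$, or the standard (hybrid) MHD model. Then the following are equivalent: (1) uniform Lopatinsky stability holds with the divergence-free constraint; (2) uniform Lopatinsky stability holds without the constraint; (3) uniform Lopatinsky stability holds for the reduced model defined by $G|_{\ker L}$.
   Context: Let $V=(\rho,\rho u_1,\rho u_2,h_1,h_2)^T\in\mathbb R^5$, $\rho>0$, $p=p(\rho)$ with $p'>0$. Define fluxes $F_1(V)=(\rho u_1,\ \rho u_1^2+\tfrac12(h_2^2-h_1^2)+p,\ \rho u_1u_2-h_1h_2,\ \beta h_1,\ u_1h_2-h_1u_2)^T$, $F_2(V)=(\rho u_2,\ \rho u_1u_2-h_1h_2,\ \rho u_2^2+\tfrac12(h_1^2-h_2^2)+p,\ \beta h_2+h_1u_2-h_2u_1,\ 0)^T$. The (inviscid, 2-D, isentropic) $\beta$-model is $V_t+F_1(V)_{x_1}+F_2(V)_{x_2}=0$. The hybrid model has as interior equation the quasilinear system obtained from the $\beta=0$ system by adding $b(V)\,\mathrm{div}\,h$ to the left side, $b=(0,h_1,h_2,u_1,u_2)^T$ (a symmetrizable hyperbolic system). Its shock jump conditions are those of the $\beta=0$ conservative system together with the jump condition $[h_1]=0$ (normal component) of $\mathrm{div}\,h=0$. The constraint is $\mathrm{div}\,h=0$, i.e. $\Gamma_1V_{x_1}+\Gamma_2V_{x_2}=0$ with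 $\Gamma_1=(0,0,0,1,0)$, $\Gamma_2=(0,0,0,0,1)$. A stationary shock is $\overline V=V_\pm$ for $x_1\gtrless0$, satisfying the jump conditions (so $[\bar h_1]=0$). Let $V_t+A_1^\pm V_{x_1}+A_2^\pm V_{x_2}=0$ be the linearization of the interior equations of the model at $V_\pm$. The shock is of Lax type if the number of outgoing characteristics (positive eigenvalues of $A_1^+$ plus negative eigenvalues of $A_1^-$) equals $n-1=4$. Normal modes: for $\xi\in\mathbb R$, $\lambda\in\mathbb C$, consider pairs $(\hat V,Y)$, $\hat V$ smooth on each side of $x_1=0$, $Y\in\mathbb C$, solving the interior equation $\hat V_{x_1}=G_\pm(\lambda,\xi)\hat V$, $G_\pm=-(A_1^\pm)^{-1}(\lambda+i\xi A_2^\pm)$, for $x_1\gtrless0$, and the linearized jump conditions $Y(\lambda[\overline V]+i\xi[F_2(\overline V)])-[DF_1(\overline V)\hat V]=0$ at $x_1=0$, where for the hybrid model the fourth component of the latter is replaced by $Y\,i\xi[\bar h_2]-[\hat V_4]=0$. For $\mathrm{Re}\,\lambda>0$ let $\mathcal E^+$ be the stable subspace of $G_+$ and $\mathcal E^-$ the unstable subspace of $G_-$. Let $L_\pm=\Gamma_1G_\pm+i\xi\Gamma_2$, so that a solution of the interior equation satisfies the transformed constraint $\hat\Gamma\hat V:=\Gamma_1\hat V_{x_1}+i\xi\Gamma_2\hat V=0$ iff it takes values in $\ker L_\pm$. $\ker L_\pm$ is $G_\pm$-invariant, the reduced model is the interior equation restricted to $\ker L_\pm$ (i.e. governed by $G_\pm|_{\ker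 L_\pm}$), and $\mathcal E_0^\pm=\mathcal E^\pm\cap\ker L_\pm$ are its decaying subspaces. Under the stated hypotheses $\mathcal E^\pm$ and $\mathcal E_0^\pm$ are understood to be extended continuously to $\mathrm{Re}\,\lambda\ge0$, $(\lambda,\xi)\ne(0,0)$. Uniform Lopatinsky stability without constraint: for no $(\lambda,\xi)\neq(0,0)$ with $\mathrm{Re}\,\lambda\ge0$, $\xi\in\mathbb R$, is there a nontrivial normal-mode solution $(\hat V,Y)$ with $\hat V(x_1)\in\mathcal E^\pm(\lambda,\xi)$ for $x_1\gtrless0$ (equivalently, the Lopatinsky determinant does not vanish there). With constraint: no such nontrivial solution which in addition satisfies $\hat\Gamma\hat V=0$ for $x_1\gtrless 0$. For the reduced model: no nontrivial solution with $\hat V(x_1)\in\mathcal E_0^\pm(\lambda,\xi)$ for $x_1\gtrless0$.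
   Formalization: On Re λ=0 the reduced decaying subspaces are taken as the extended E^± intersected with ker L_±, not as the limit of E_0^± itself; with the latter the equivalence with (3) fails for the β-model (e.g. β<0, h=0 gas shock). *)

theory Defs
  imports "HOL-Analysis.Analysis"
begin

text \<open>
  States are \<open>V = (\<rho>, \<rho> u\<^sub>1, \<rho> u\<^sub>2, h\<^sub>1, h\<^sub>2)\<close>; all derivatives of the fluxes are taken
  with respect to these conserved variables. The index type 5 has the elements
  1, 2, 3, 4, 5 (with 5 = 0), matching the numbering used by \<open>vector\<close>.
\<close>

definition rho :: "real^5 \<Rightarrow> real" where "rho V = V $ 1"
definition u1 :: "real^5 \<Rightarrow> real" where "u1 V = V $ 2 / V $ 1"
definition u2 :: "real^5 \<Rightarrow> real" where "u2 V = V $ 3 / V $ 1"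
definition h1 :: "real^5 \<Rightarrow> real" where "h1 V = V $ 4"
definition h2 :: "real^5 \<Rightarrow> real" where "h2 V = V $ 5"

definition beta_flux1 :: "real \<Rightarrow> (real \<Rightarrow> real) \<Rightarrow> real^5 \<Rightarrow> real^5" where
  "beta_flux1 \<beta> p V = vector
     [rho V * u1 V,
      rho V * (u1 V)\<^sup>2 + ((h2 V)\<^sup>2 - (h1 V)\<^sup>2) / 2 + p (rho V),
      rho V * u1 V * u2 V - h1 V * h2 V,
      \<beta> * h1 V,
      u1 V * h2 V - h1 V * u2 V]"

definition beta_flux2 :: "real \<Rightarrow> (real \<Rightarrow> real) \<Rightarrow> real^5 \<Rightarrow> real^5" where
  "beta_flux2 \<beta> p V = vector
     [rho V * u2 V,
      rho V * u1 V * u2 V - h1 V * h2 V,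
      rho V * (u2 V)\<^sup>2 + ((h1 V)\<^sup>2 - (h2 V)\<^sup>2) / 2 + p (rho V),
      \<beta> * h2 V + h1 V * u2 V - h2 V * u1 V,
      0]"

text \<open>The constraint \<open>div h = 0\<close> is \<open>\<Gamma>\<^sub>1 V\<^bsub>x1\<^esub> + \<Gamma>\<^sub>2 V\<^bsub>x2\<^esub> = 0\<close>, with row vectors \<open>\<Gamma>\<^sub>j\<close>.\<close>

definition Gamma1 :: "'a::zero_neq_one^5" where "Gamma1 = vector [0, 0, 0, 1, 0]"
definition Gamma2 :: "'a::zero_neq_one^5" where "Gamma2 = vector [0, 0, 0, 0, 1]"

definition row_apply :: "complex^5 \<Rightarrow> complex^5 \<Rightarrow> complex" where
  "row_apply a v = (\<Sum>i\<in>UNIV. a $ i * v $ i)"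

definition b_hybrid :: "real^5 \<Rightarrow> real^5" where
  "b_hybrid V = vector [0, h1 V, h2 V, u1 V, u2 V]"

datatype mhd_model = Beta_Model real | Hybrid_Model

text \<open>
  The conservative fluxes occurring in the jump conditions; those of the hybrid model are
  the fluxes with \<open>\<beta> = 0\<close>, although its interior equation is not conservative.
\<close>

fun flux1 :: "mhd_model \<Rightarrow> (real \<Rightarrow> real) \<Rightarrow> real^5 \<Rightarrow> real^5" where
  "flux1 (Beta_Model \<beta>) p = beta_flux1 \<beta> p"
| "flux1 Hybrid_Model p = beta_flux1 0 p"

fun flux2 :: "mhd_model \<Rightarrow> (real \<Rightarrow> real) \<Rightarrow> real^5 \<Rightarrow> real^5" where
  "flux2 (Beta_Model \<beta>) p = beta_flux2 \<beta> p"
| "flux2 Hybrid_Model p = beta_flux2 0 p"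

definition row_outer :: "real^5 \<Rightarrow> real^5 \<Rightarrow> real^5^5" where
  "row_outer b g = (\<chi> i j. b $ i * g $ j)"

text \<open>Coefficient matrices of the interior equation \<open>V\<^sub>t + A\<^sub>1 V\<^bsub>x1\<^esub> + A\<^sub>2 V\<^bsub>x2\<^esub> = 0\<close> linearized at \<open>V\<close>.\<close>

fun A1 :: "mhd_model \<Rightarrow> (real \<Rightarrow> real) \<Rightarrow> real^5 \<Rightarrow> real^5^5" where
  "A1 (Beta_Model \<beta>) p V = jacobian (beta_flux1 \<beta> p) (at V)"
| "A1 Hybrid_Model p V = jacobian (beta_flux1 0 p) (at V) + row_outer (b_hybrid V) Gamma1"

fun A2 :: "mhd_model \<Rightarrow> (real \<Rightarrow> real) \<Rightarrow> real^5 \<Rightarrow> real^5^5" where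
  "A2 (Beta_Model \<beta>) p V = jacobian (beta_flux2 \<beta> p) (at V)"
| "A2 Hybrid_Model p V = jacobian (beta_flux2 0 p) (at V) + row_outer (b_hybrid V) Gamma2"

subsection \<open>Shocks\<close>

fun stationary_shock :: "mhd_model \<Rightarrow> (real \<Rightarrow> real) \<Rightarrow> real^5 \<Rightarrow> real^5 \<Rightarrow> bool" where
  "stationary_shock (Beta_Model \<beta>) p Vp Vm \<longleftrightarrow>
     rho Vp > 0 \<and> rho Vm > 0 \<and> beta_flux1 \<beta> p Vp = beta_flux1 \<beta> p Vm"
| "stationary_shock Hybrid_Model p Vp Vm \<longleftrightarrow>
     rho Vp > 0 \<and> rho Vm > 0 \<and> beta_flux1 0 p Vp = beta_flux1 0 p Vm \<and> h1 Vp = h1 Vm"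

definition charpoly :: "real^5^5 \<Rightarrow> real poly" where
  "charpoly A = det (\<chi> i j. (if i = j then [:0, 1:] else 0) - [:A $ i $ j:])"

text \<open>Eigenvalues are counted with algebraic multiplicity.\<close>

definition num_pos_eigenvalues :: "real^5^5 \<Rightarrow> nat" where
  "num_pos_eigenvalues A = (\<Sum>x | poly (charpoly A) x = 0 \<and> x > 0. order x (charpoly A))"

definition num_neg_eigenvalues :: "real^5^5 \<Rightarrow> nat" where
  "num_neg_eigenvalues A = (\<Sum>x | poly (charpoly A) x = 0 \<and> x < 0. order x (charpoly A))"

definition lax_type :: "mhd_model \<Rightarrow> (real \<Rightarrow> real) \<Rightarrow> real^5 \<Rightarrow> real^5 \<Rightarrow> bool" where
  "lax_type m p Vp Vm \<longleftrightarrow>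
     num_pos_eigenvalues (A1 m p Vp) + num_neg_eigenvalues (A1 m p Vm) = 4"

definition noncharacteristic :: "mhd_model \<Rightarrow> (real \<Rightarrow> real) \<Rightarrow> real^5 \<Rightarrow> real^5 \<Rightarrow> bool" where
  "noncharacteristic m p Vp Vm \<longleftrightarrow> det (A1 m p Vp) \<noteq> 0 \<and> det (A1 m p Vm) \<noteq> 0"

subsection \<open>Decaying subspaces\<close>

abbreviation cvec :: "real^5 \<Rightarrow> complex^5" where
  "cvec v \<equiv> (\<chi> i. complex_of_real (v $ i))"

abbreviation cmat :: "real^5^5 \<Rightarrow> complex^5^5" where
  "cmat A \<equiv> map_matrix complex_of_real A"

definition G :: "mhd_model \<Rightarrow> (real \<Rightarrow> real) \<Rightarrow> real^5 \<Rightarrow> complex \<Rightarrow> real \<Rightarrow> complex^5^5" where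
  "G m p V lam \<xi> = - (matrix_inv (cmat (A1 m p V)) **
     (mat lam + map_matrix (\<lambda>a. \<i> * complex_of_real \<xi> * complex_of_real a) (A2 m p V)))"

definition gen_eigenspace :: "complex^5^5 \<Rightarrow> complex \<Rightarrow> (complex^5) set" where
  "gen_eigenspace M \<mu> = {v. \<exists>k. ((\<lambda>w. M *v w - \<mu> *s w) ^^ k) v = 0}"

definition stable_subspace :: "complex^5^5 \<Rightarrow> (complex^5) set" where
  "stable_subspace M = vec.span (\<Union>\<mu>\<in>{\<mu>. Re \<mu> < 0}. gen_eigenspace M \<mu>)"

definition unstable_subspace :: "complex^5^5 \<Rightarrow> (complex^5) set" where
  "unstable_subspace M = vec.span (\<Union>\<mu>\<in>{\<mu>. Re \<mu> > 0}. gen_eigenspace M \<mu>)"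

text \<open>
  Continuous extension of a family of subspaces from \<open>Re \<lambda> > 0\<close> to \<open>Re \<lambda> \<ge> 0\<close>: the value at a
  boundary frequency consists of the limits of convergent selections of the family. This is
  the limit of the family in the Grassmannian whenever that limit exists.
\<close>

definition extend :: "(complex \<Rightarrow> real \<Rightarrow> (complex^5) set) \<Rightarrow> complex \<Rightarrow> real \<Rightarrow> (complex^5) set" where
  "extend S lam \<xi> =
     (if Re lam > 0 then S lam \<xi>
      else {v. \<exists>w. (\<forall>l x. Re l > 0 \<longrightarrow> w (l, x) \<in> S l x) \<and>
                   (w \<longlongrightarrow> v) (at (lam, \<xi>) within {q. Re (fst q) > 0})})"

definition E_plus :: "mhd_model \<Rightarrow> (real \<Rightarrow> real) \<Rightarrow> real^5 \<Rightarrow> complex \<Rightarrow> real \<Rightarrow> (complex^5) set" where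
  "E_plus m p Vp = extend (\<lambda>lam \<xi>. stable_subspace (G m p Vp lam \<xi>))"

definition E_minus :: "mhd_model \<Rightarrow> (real \<Rightarrow> real) \<Rightarrow> real^5 \<Rightarrow> complex \<Rightarrow> real \<Rightarrow> (complex^5) set" where
  "E_minus m p Vm = extend (\<lambda>lam \<xi>. unstable_subspace (G m p Vm lam \<xi>))"

definition L :: "mhd_model \<Rightarrow> (real \<Rightarrow> real) \<Rightarrow> real^5 \<Rightarrow> complex \<Rightarrow> real \<Rightarrow> complex^5" where
  "L m p V lam \<xi> = Gamma1 v* G m p V lam \<xi> + (\<i> * complex_of_real \<xi>) *s Gamma2"

definition ker_L :: "mhd_model \<Rightarrow> (real \<Rightarrow> real) \<Rightarrow> real^5 \<Rightarrow> complex \<Rightarrow> real \<Rightarrow> (complex^5) set" where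
  "ker_L m p V lam \<xi> = {v. row_apply (L m p V lam \<xi>) v = 0}"

text \<open>
  The decaying subspaces of the reduced model. The identity \<open>\<E>\<^sub>0 = \<E> \<inter> ker L\<close> is kept on
  \<open>Re \<lambda> = 0\<close>, with \<open>\<E>\<close> the extended subspace. Where \<open>\<E> \<inter> ker L\<close> depends continuously on
  the frequency, this is the continuous extension of \<open>\<E>\<^sub>0\<close> from \<open>Re \<lambda> > 0\<close>. For the
  \<open>\<beta>\<close>-model, however, the eigenvector of \<open>G\<close> for the constraint mode \<open>- \<lambda> / \<beta>\<close> can tend to
  an element of \<open>ker L\<close> as \<open>Re \<lambda>\<close> tends to 0, and then the limit of \<open>\<E>\<^sub>0\<close> alone is
  strictly smaller than \<open>\<E> \<inter> ker L\<close>.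
\<close>

definition E0_plus :: "mhd_model \<Rightarrow> (real \<Rightarrow> real) \<Rightarrow> real^5 \<Rightarrow> complex \<Rightarrow> real \<Rightarrow> (complex^5) set" where
  "E0_plus m p Vp lam \<xi> = E_plus m p Vp lam \<xi> \<inter> ker_L m p Vp lam \<xi>"

definition E0_minus :: "mhd_model \<Rightarrow> (real \<Rightarrow> real) \<Rightarrow> real^5 \<Rightarrow> complex \<Rightarrow> real \<Rightarrow> (complex^5) set" where
  "E0_minus m p Vm lam \<xi> = E_minus m p Vm lam \<xi> \<inter> ker_L m p Vm lam \<xi>"

subsection \<open>Normal modes\<close>

text \<open>Here \<open>vp\<close>, \<open>vm\<close> are the one-sided traces at \<open>x\<^sub>1 = 0\<close>, and jumps are right minus left.\<close>

definition jump_residual ::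
  "mhd_model \<Rightarrow> (real \<Rightarrow> real) \<Rightarrow> real^5 \<Rightarrow> real^5 \<Rightarrow> complex \<Rightarrow> real \<Rightarrow> complex
   \<Rightarrow> complex^5 \<Rightarrow> complex^5 \<Rightarrow> complex^5" where
  "jump_residual m p Vp Vm lam \<xi> Y vp vm =
     Y *s (lam *s cvec (Vp - Vm)
           + (\<i> * complex_of_real \<xi>) *s cvec (flux2 m p Vp - flux2 m p Vm))
     - (cmat (jacobian (flux1 m p) (at Vp)) *v vp - cmat (jacobian (flux1 m p) (at Vm)) *v vm)"

fun linearized_jump ::
  "mhd_model \<Rightarrow> (real \<Rightarrow> real) \<Rightarrow> real^5 \<Rightarrow> real^5 \<Rightarrow> complex \<Rightarrow> real \<Rightarrow> complex
   \<Rightarrow> complex^5 \<Rightarrow> complex^5 \<Rightarrow> bool" where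
  "linearized_jump (Beta_Model \<beta>) p Vp Vm lam \<xi> Y vp vm \<longleftrightarrow>
     jump_residual (Beta_Model \<beta>) p Vp Vm lam \<xi> Y vp vm = 0"
| "linearized_jump Hybrid_Model p Vp Vm lam \<xi> Y vp vm \<longleftrightarrow>
     (\<forall>i. i \<noteq> 4 \<longrightarrow> jump_residual Hybrid_Model p Vp Vm lam \<xi> Y vp vm $ i = 0) \<and>
     Y * (\<i> * complex_of_real \<xi>) * complex_of_real (h2 Vp - h2 Vm) - (vp $ 4 - vm $ 4) = 0"

text \<open>
  The value of \<open>V\<close> at 0 is irrelevant. Smoothness on each side is a consequence of the
  linear constant-coefficient equation.
\<close>

definition normal_mode ::
  "mhd_model \<Rightarrow> (real \<Rightarrow> real) \<Rightarrow> real^5 \<Rightarrow> real^5 \<Rightarrow> complex \<Rightarrow> real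
   \<Rightarrow> (real \<Rightarrow> complex^5) \<Rightarrow> complex \<Rightarrow> bool" where
  "normal_mode m p Vp Vm lam \<xi> V Y \<longleftrightarrow>
     (\<forall>x>0. (V has_vector_derivative G m p Vp lam \<xi> *v V x) (at x)) \<and>
     (\<forall>x<0. (V has_vector_derivative G m p Vm lam \<xi> *v V x) (at x)) \<and>
     (\<exists>vp vm. (V \<longlongrightarrow> vp) (at_right 0) \<and> (V \<longlongrightarrow> vm) (at_left 0) \<and>
              linearized_jump m p Vp Vm lam \<xi> Y vp vm)"

definition nontrivial_mode :: "(real \<Rightarrow> complex^5) \<Rightarrow> complex \<Rightarrow> bool" where
  "nontrivial_mode V Y \<longleftrightarrow> Y \<noteq> 0 \<or> (\<exists>x. x \<noteq> 0 \<and> V x \<noteq> 0)"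

definition constraint_mode :: "real \<Rightarrow> (real \<Rightarrow> complex^5) \<Rightarrow> bool" where
  "constraint_mode \<xi> V \<longleftrightarrow>
     (\<forall>x. x \<noteq> 0 \<longrightarrow> row_apply Gamma1 (vector_derivative V (at x))
                    + \<i> * complex_of_real \<xi> * row_apply Gamma2 (V x) = 0)"

definition stable_without_constraint ::
  "mhd_model \<Rightarrow> (real \<Rightarrow> real) \<Rightarrow> real^5 \<Rightarrow> real^5 \<Rightarrow> bool" where
  "stable_without_constraint m p Vp Vm \<longleftrightarrow>
     (\<forall>lam \<xi>. (lam, \<xi>) \<noteq> (0, 0) \<and> Re lam \<ge> 0 \<longrightarrow>
        \<not> (\<exists>V Y. normal_mode m p Vp Vm lam \<xi> V Y \<and> nontrivial_mode V Y \<and>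
               (\<forall>x>0. V x \<in> E_plus m p Vp lam \<xi>) \<and> (\<forall>x<0. V x \<in> E_minus m p Vm lam \<xi>)))"

definition stable_with_constraint ::
  "mhd_model \<Rightarrow> (real \<Rightarrow> real) \<Rightarrow> real^5 \<Rightarrow> real^5 \<Rightarrow> bool" where
  "stable_with_constraint m p Vp Vm \<longleftrightarrow>
     (\<forall>lam \<xi>. (lam, \<xi>) \<noteq> (0, 0) \<and> Re lam \<ge> 0 \<longrightarrow>
        \<not> (\<exists>V Y. normal_mode m p Vp Vm lam \<xi> V Y \<and> nontrivial_mode V Y \<and>
               (\<forall>x>0. V x \<in> E_plus m p Vp lam \<xi>) \<and> (\<forall>x<0. V x \<in> E_minus m p Vm lam \<xi>) \<and>
               constraint_mode \<xi> V))"

text \<open>On \<open>ker L\<close>-valued functions the interior equation is that of \<open>G\<close> restricted to \<open>ker L\<close>.\<close>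

definition stable_reduced ::
  "mhd_model \<Rightarrow> (real \<Rightarrow> real) \<Rightarrow> real^5 \<Rightarrow> real^5 \<Rightarrow> bool" where
  "stable_reduced m p Vp Vm \<longleftrightarrow>
     (\<forall>lam \<xi>. (lam, \<xi>) \<noteq> (0, 0) \<and> Re lam \<ge> 0 \<longrightarrow>
        \<not> (\<exists>V Y. normal_mode m p Vp Vm lam \<xi> V Y \<and> nontrivial_mode V Y \<and>
               (\<forall>x>0. V x \<in> E0_plus m p Vp lam \<xi>) \<and> (\<forall>x<0. V x \<in> E0_minus m p Vm lam \<xi>)))"

end

theory Submission
  imports Defs
begin

text \<open>
  Taking the divergence of the magnetic equations shows that \<open>div h\<close> solves a transport equation
  of its own: \<open>L\<close> is a left eigenvector of \<open>G\<close> for the eigenvalue \<open>- (\<lambda> + i \<xi> d) / c\<close>, where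
  \<open>(c, d)\<close> is \<open>(\<beta>, 0)\<close> for the \<open>\<beta>\<close>-model and \<open>(u\<^sub>1, u\<^sub>2)\<close> for the hybrid model. The normal speed
  \<open>c\<close> is nonzero and has the same sign on both sides of the shock. Hence on the upstream side of
  this transport the constraint mode does not belong to the decaying subspace, which therefore
  lies in \<open>ker L\<close>. The fourth and fifth linearized jump conditions give \<open>[c L V] = 0\<close>, so the
  trace of \<open>L V\<close> vanishes on the downstream side as well, and so does \<open>L V\<close> itself by uniqueness for
  its scalar equation. Thus every normal mode satisfies the constraint.
\<close>

lemma exhaust_5:
  fixes x :: 5
  shows "x = 1 \<or> x = 2 \<or> x = 3 \<or> x = 4 \<or> x = 5"
proof (induct x)
  case (of_int z)
  then have "z = 0 \<or> z = 1 \<or> z = 2 \<or> z = 3 \<or> z = 4"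
    by (simp; fastforce)
  then show ?case
    by auto
qed

lemma vector_5 [simp]:
  "(vector [x1, x2, x3, x4, x5] :: 'a::zero^5) $ 1 = x1"
  "(vector [x1, x2, x3, x4, x5] :: 'a^5) $ 2 = x2"
  "(vector [x1, x2, x3, x4, x5] :: 'a^5) $ 3 = x3"
  "(vector [x1, x2, x3, x4, x5] :: 'a^5) $ 4 = x4"
  "(vector [x1, x2, x3, x4, x5] :: 'a^5) $ 5 = x5"
  unfolding vector_def by auto

lemma UNIV_5: "(UNIV :: 5 set) = {1, 2, 3, 4, 5}"
  using exhaust_5 by auto

lemma sum_5: "sum f (UNIV :: 5 set) = f 1 + f 2 + f 3 + f 4 + f 5"
  unfolding UNIV_5 by (simp add: ac_simps)

lemma differentiable_componentwise_vec:
  fixes f :: "'a::real_normed_vector \<Rightarrow> real^'n"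
  assumes "\<And>i. (\<lambda>x. f x $ i) differentiable F"
  shows "f differentiable F"
proof -
  have "f = (\<lambda>x. \<Sum>i\<in>UNIV. f x $ i *\<^sub>R axis i 1)"
    by (auto simp: vec_eq_iff axis_def if_distrib cong: if_cong)
  moreover have "(\<lambda>x. f x $ i *\<^sub>R (axis i 1 :: real^'n)) differentiable F" for i
    using assms[of i] has_derivative_scaleR_left unfolding differentiable_def by blast
  then have "(\<lambda>x. \<Sum>i\<in>UNIV. f x $ i *\<^sub>R (axis i 1 :: real^'n)) differentiable F"
    by (intro differentiable_sum) auto
  ultimately show ?thesis by simp
qed

lemma vec_nth_differentiable [simp]: "(\<lambda>V :: real^'n. V $ i) differentiable F"
  by (simp add: bounded_linear_imp_differentiable bounded_linear_vec_nth)

lemma jacobian_row: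
  fixes f :: "real^'n \<Rightarrow> real^'k"
  assumes "f differentiable (at V)" and "((\<lambda>W. f W $ i) has_derivative (\<lambda>h. \<Sum>j\<in>UNIV. r $ j * h $ j)) (at V)"
  shows "jacobian f (at V) $ i = r"
proof -
  let ?J = "jacobian f (at V)"
  have "((\<lambda>W. f W $ i) has_derivative (\<lambda>h. (?J *v h) $ i)) (at V)"
    using assms(1) unfolding jacobian_works
    by (rule bounded_linear.has_derivative[OF bounded_linear_vec_nth])
  from has_derivative_unique[OF this assms(2)]
  have *: "(?J *v axis k 1) $ i = (\<Sum>j\<in>UNIV. r $ j * axis k 1 $ j)" for k
    by (rule fun_cong)
  show ?thesis
  proof (subst vec_eq_iff, rule allI)
    fix k
    show "?J $ i $ k = r $ k"
      using *[of k] by (simp add: matrix_vector_mult_def axis_def if_distrib cong: if_cong)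
  qed
qed

lemma row_has_derivative:
  fixes f :: "real^'n \<Rightarrow> real^'k"
  assumes "f differentiable (at V)"
  shows "((\<lambda>W. f W $ i) has_derivative (\<lambda>h. \<Sum>j\<in>UNIV. jacobian f (at V) $ i $ j * h $ j)) (at V)"
  using bounded_linear.has_derivative[OF bounded_linear_vec_nth, of f "(*v) (jacobian f (at V))" "at V" i]
    assms unfolding jacobian_works by (simp add: matrix_vector_mult_def)

lemma beta_flux_differentiable:
  assumes "V $ 1 \<noteq> 0" and "p differentiable (at (V $ 1))"
  shows "beta_flux1 \<beta> p differentiable (at V)" "beta_flux2 \<beta> p differentiable (at V)"
proof -
  have p: "(\<lambda>W :: real^5. p (W $ 1)) differentiable (at V)"
    using differentiable_chain_at[of "\<lambda>W :: real^5. W $ 1" V p] assms(2) by (simp add: o_def)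
  show "beta_flux1 \<beta> p differentiable (at V)" "beta_flux2 \<beta> p differentiable (at V)"
  proof (rule_tac [!] differentiable_componentwise_vec)
    fix i :: 5
    show "(\<lambda>x. beta_flux1 \<beta> p x $ i) differentiable at V"
      using exhaust_5[of i] assms(1) p
      by (elim disjE; simp only: beta_flux1_def rho_def u1_def u2_def h1_def h2_def vector_5;
          intro derivative_intros; simp)
    show "(\<lambda>x. beta_flux2 \<beta> p x $ i) differentiable at V"
      using exhaust_5[of i] assms(1) p
      by (elim disjE; simp only: beta_flux2_def rho_def u1_def u2_def h1_def h2_def vector_5;
          intro derivative_intros; simp)
  qed
qed

lemma jacobian_flux_rows:
  assumes V: "V $ 1 \<noteq> 0" and p: "p differentiable (at (V $ 1))"
  shows "jacobian (beta_flux1 \<beta> p) (at V) $ 4 = \<beta> *\<^sub>R Gamma1"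
    and "jacobian (beta_flux2 \<beta> p) (at V) $ 4 = \<beta> *\<^sub>R Gamma2 - jacobian (beta_flux1 \<beta> p) (at V) $ 5"
    and "jacobian (beta_flux2 \<beta> p) (at V) $ 5 = 0"
proof -
  note d = beta_flux_differentiable[OF V p, of \<beta>]
  show "jacobian (beta_flux1 \<beta> p) (at V) $ 4 = \<beta> *\<^sub>R Gamma1"
    by (rule jacobian_row[OF d(1)])
      (auto simp: beta_flux1_def h1_def Gamma1_def sum_5 simp del: zero_neq_one
        intro!: derivative_eq_intros bounded_linear.has_derivative[OF bounded_linear_vec_nth])
  have "((\<lambda>W. \<beta> * W $ 5 - beta_flux1 \<beta> p W $ 5) has_derivative
      (\<lambda>h. \<beta> * h $ 5 - (\<Sum>j\<in>UNIV. jacobian (beta_flux1 \<beta> p) (at V) $ 5 $ j * h $ j))) (at V)"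
    by (intro derivative_intros row_has_derivative d
        bounded_linear.has_derivative[OF bounded_linear_vec_nth])
  then show "jacobian (beta_flux2 \<beta> p) (at V) $ 4
      = \<beta> *\<^sub>R Gamma2 - jacobian (beta_flux1 \<beta> p) (at V) $ 5"
    by (intro jacobian_row[OF d(2)])
      (simp add: beta_flux1_def beta_flux2_def h1_def h2_def Gamma2_def sum_5 algebra_simps)
  show "jacobian (beta_flux2 \<beta> p) (at V) $ 5 = 0"
    by (rule jacobian_row[OF d(2)]) (simp add: beta_flux2_def)
qed

text \<open>
  In every model \<open>div h\<close> is transported with a constant velocity, whose components are the
  following two speeds.
\<close>

fun div_speed1 :: "mhd_model \<Rightarrow> real^5 \<Rightarrow> real" where
  "div_speed1 (Beta_Model \<beta>) V = \<beta>"
| "div_speed1 Hybrid_Model V = u1 V"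

fun div_speed2 :: "mhd_model \<Rightarrow> real^5 \<Rightarrow> real" where
  "div_speed2 (Beta_Model \<beta>) V = 0"
| "div_speed2 Hybrid_Model V = u2 V"

lemma interior_rows:
  assumes V: "V $ 1 \<noteq> 0" and p: "p differentiable (at (V $ 1))"
  shows "A1 m p V $ 4 = div_speed1 m V *\<^sub>R Gamma1"
    and "A1 m p V $ 5 = jacobian (flux1 m p) (at V) $ 5 + div_speed2 m V *\<^sub>R Gamma1"
    and "A2 m p V $ 4 = div_speed1 m V *\<^sub>R Gamma2 - jacobian (flux1 m p) (at V) $ 5"
    and "A2 m p V $ 5 = div_speed2 m V *\<^sub>R Gamma2"
  by (cases m; simp add: jacobian_flux_rows[OF V p] row_outer_def b_hybrid_def vec_eq_iff
      plus_vec_def)+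

lemma row_apply_linear [simp]:
  "row_apply (a + b) v = row_apply a v + row_apply b v"
  "row_apply (a - b) v = row_apply a v - row_apply b v"
  "row_apply (c *s a) v = c * row_apply a v"
  "row_apply a (v + w) = row_apply a v + row_apply a w"
  "row_apply a (v - w) = row_apply a v - row_apply a w"
  "row_apply a (c *s v) = c * row_apply a v"
  "row_apply a (- v) = - row_apply a v"
  "row_apply a 0 = 0"
  by (simp_all add: row_apply_def sum.distrib sum_subtractf sum_distrib_left sum_negf algebra_simps)

lemma row_apply_Gamma [simp]: "row_apply Gamma1 v = v $ 4" "row_apply Gamma2 v = v $ 5"
  by (simp_all add: row_apply_def Gamma1_def Gamma2_def sum_5 del: one_neq_zero)

lemma row_apply_vector_matrix: "row_apply (a v* M) v = row_apply a (M *v v)"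
  unfolding row_apply_def vector_matrix_mult_def matrix_vector_mult_def
  by (simp add: sum_distrib_left sum_distrib_right) (subst sum.swap, simp add: ac_simps)

lemma cmat_mult_nth: "(cmat A *v v) $ i = row_apply (cvec (A $ i)) v"
  by (simp add: matrix_vector_mult_def row_apply_def)

lemma cvec_linear:
  "cvec (a + b) = cvec a + cvec b" "cvec (a - b) = cvec a - cvec b"
  "cvec (c *\<^sub>R a) = complex_of_real c *s cvec a"
  by (simp_all add: vec_eq_iff)

lemma cvec_Gamma: "cvec Gamma1 = Gamma1" "cvec Gamma2 = Gamma2"
proof -
  have 1: "cvec Gamma1 $ i = Gamma1 $ i" and 2: "cvec Gamma2 $ i = Gamma2 $ i" for i :: 5
    using exhaust_5[of i] by (auto simp: Gamma1_def Gamma2_def)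
  show "cvec Gamma1 = Gamma1" unfolding vec_eq_iff using 1 by blast
  show "cvec Gamma2 = Gamma2" unfolding vec_eq_iff using 2 by blast
qed

lemma cmat_matrix_inv:
  assumes "det A \<noteq> 0"
  shows "cmat A ** matrix_inv (cmat A) = mat 1"
proof -
  have c: "cmat X ** cmat Y = cmat (X ** Y)" for X Y :: "real^5^5"
    by (simp add: vec_eq_iff matrix_matrix_mult_def)
  have c1: "cmat (mat 1) = mat 1"
    by (simp add: vec_eq_iff mat_def)
  from assms obtain B where "A ** B = mat 1" "B ** A = mat 1"
    by (auto simp: invertible_det_nz[symmetric] invertible_def)
  then have "\<exists>B. cmat A ** B = mat 1 \<and> B ** cmat A = mat 1"
    by (intro exI[of _ "cmat B"]) (simp add: c c1)
  then show ?thesis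
    unfolding matrix_inv_def by (rule someI2_ex) simp
qed

lemma A1_mult_G:
  assumes "det (A1 m p V) \<noteq> 0"
  shows "cmat (A1 m p V) *v (G m p V lam \<xi> *v v)
    = - (lam *s v + (\<i> * complex_of_real \<xi>) *s (cmat (A2 m p V) *v v))"
proof -
  have neg: "(- M) *v v = - (M *v v)" for M :: "complex^5^5"
    by (simp add: vec_eq_iff matrix_vector_mult_def sum_negf)
  have scal: "map_matrix (\<lambda>a. k * complex_of_real a) M *v v = k *s (cmat M *v v)" for k M
    by (simp add: vec_eq_iff matrix_vector_mult_def sum_distrib_left ac_simps)
  have m: "mat lam *v v = lam *s v"
    by (simp add: vec_eq_iff matrix_vector_mult_def mat_def if_distrib if_distribR cong: if_cong)
  have negr: "M *v (- w) = - (M *v w)" for M :: "complex^5^5" and w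
    by (simp add: vec_eq_iff matrix_vector_mult_def sum_negf)
  show ?thesis
    unfolding G_def neg negr
    by (simp only: matrix_vector_mul_assoc matrix_mul_assoc cmat_matrix_inv[OF assms] matrix_mul_lid
        matrix_vector_mult_add_rdistrib scal m)
qed

locale regular_state =
  fixes m :: mhd_model and p :: "real \<Rightarrow> real" and V :: "real^5"
  assumes rho: "V $ 1 \<noteq> 0" and p: "p differentiable (at (V $ 1))" and det: "det (A1 m p V) \<noteq> 0"
begin

abbreviation "c \<equiv> complex_of_real (div_speed1 m V)"
abbreviation "d \<equiv> complex_of_real (div_speed2 m V)"
abbreviation "a \<equiv> cvec (jacobian (flux1 m p) (at V) $ 5)"
abbreviation "GG \<equiv> G m p V"
abbreviation "LL lam \<xi> \<equiv> row_apply (L m p V lam \<xi>)"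

lemma div_speed1_nonzero: "div_speed1 m V \<noteq> 0"
proof
  assume "div_speed1 m V = 0"
  then have "row 4 (A1 m p V) = 0"
    by (simp add: row_def interior_rows(1)[OF rho p] vec_eq_iff)
  then show False
    using det_zero_row(2) det by blast
qed

lemma complex_rows:
  "cvec (A1 m p V $ 4) = c *s Gamma1" "cvec (A1 m p V $ 5) = a + d *s Gamma1"
  "cvec (A2 m p V $ 4) = c *s Gamma2 - a" "cvec (A2 m p V $ 5) = d *s Gamma2"
  by (simp_all only: interior_rows[OF rho p] cvec_linear cvec_Gamma)

lemma G_components:
  "c * (GG lam \<xi> *v v) $ 4 = - lam * v $ 4 + \<i> * complex_of_real \<xi> * (row_apply a v - c * v $ 5)"
  "row_apply a (GG lam \<xi> *v v) + d * (GG lam \<xi> *v v) $ 4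
    = - lam * v $ 5 - \<i> * complex_of_real \<xi> * d * v $ 5"
  using arg_cong[OF A1_mult_G[OF det, of lam \<xi> v], of "\<lambda>w. w $ 4"]
    arg_cong[OF A1_mult_G[OF det, of lam \<xi> v], of "\<lambda>w. w $ 5"]
  by (simp_all add: cmat_mult_nth complex_rows algebra_simps)

lemma L_apply: "LL lam \<xi> v = (GG lam \<xi> *v v) $ 4 + \<i> * complex_of_real \<xi> * v $ 5"
  by (simp add: L_def row_apply_vector_matrix)

text \<open>No derivative is left on the right, so that the jump conditions apply to it.\<close>

lemma speed_L: "c * LL lam \<xi> v = - lam * v $ 4 + \<i> * complex_of_real \<xi> * row_apply a v"
  using G_components(1)[of lam \<xi> v] by (simp add: L_apply algebra_simps)

definition rate :: "complex \<Rightarrow> real \<Rightarrow> complex" where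
  "rate lam \<xi> = - (lam + \<i> * complex_of_real \<xi> * d) / c"

lemma L_eigenvector: "LL lam \<xi> (GG lam \<xi> *v v) = rate lam \<xi> * LL lam \<xi> v"
proof -
  let ?i = "\<i> * complex_of_real \<xi>"
  have "c * LL lam \<xi> (GG lam \<xi> *v v)
      = - lam * (GG lam \<xi> *v v) $ 4 + ?i * row_apply a (GG lam \<xi> *v v)"
    by (rule speed_L)
  also have "row_apply a (GG lam \<xi> *v v) = - lam * v $ 5 - d * LL lam \<xi> v"
    using G_components(2)[of lam \<xi> v] by (simp add: L_apply algebra_simps)
  also have "(GG lam \<xi> *v v) $ 4 = LL lam \<xi> v - ?i * v $ 5"
    by (simp add: L_apply)
  finally have "c * LL lam \<xi> (GG lam \<xi> *v v) = - (lam + ?i * d) * LL lam \<xi> v"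
    by (simp add: algebra_simps)
  then show ?thesis
    using div_speed1_nonzero by (simp add: rate_def field_simps)
qed

lemma Re_rate: "Re (rate lam \<xi>) = - Re lam / div_speed1 m V"
  by (simp add: rate_def)

lemma L_gen_eigenspace:
  assumes "v \<in> gen_eigenspace (GG lam \<xi>) \<mu>" "\<mu> \<noteq> rate lam \<xi>"
  shows "LL lam \<xi> v = 0"
proof -
  obtain k where k: "((\<lambda>w. GG lam \<xi> *v w - \<mu> *s w) ^^ k) v = 0"
    using assms(1) by (auto simp: gen_eigenspace_def)
  have "LL lam \<xi> (((\<lambda>w. GG lam \<xi> *v w - \<mu> *s w) ^^ k) v) = (rate lam \<xi> - \<mu>) ^ k * LL lam \<xi> v"
    by (induction k) (simp_all add: L_eigenvector algebra_simps)
  then show ?thesis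
    using k assms(2) by simp
qed

lemma L_span:
  assumes "v \<in> vec.span (\<Union>\<mu>\<in>S. gen_eigenspace (GG lam \<xi>) \<mu>)" "rate lam \<xi> \<notin> S"
  shows "LL lam \<xi> v = 0"
  using assms(1)
  by (induction rule: vec.span_induct_alt) (use L_gen_eigenspace assms(2) in force)+

lemma L_extend:
  assumes S: "\<And>l x w. Re l > 0 \<Longrightarrow> w \<in> S l x \<Longrightarrow> LL l x w = 0"
    and v: "v \<in> extend S lam \<xi>" and lam: "Re lam \<ge> 0"
  shows "LL lam \<xi> v = 0"
proof (cases "Re lam > 0")
  case True
  then show ?thesis using S v by (simp add: extend_def)
next
  case False
  then obtain w where w: "\<And>l x. Re l > 0 \<Longrightarrow> w (l, x) \<in> S l x"
    and lim: "(w \<longlongrightarrow> v) (at (lam, \<xi>) within {q. Re (fst q) > 0})"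
    using v by (auto simp: extend_def)
  define l where "l = (\<lambda>t. lam + complex_of_real t)"
  have l0: "(l \<longlongrightarrow> lam) (at_right 0)"
    unfolding l_def by (auto intro!: tendsto_eq_intros)
  have ev: "\<forall>\<^sub>F t in at_right 0. Re (l t) > 0 \<and> (l t, \<xi>) \<noteq> (lam, \<xi>)"
    using eventually_at_right_less[of "0 :: real"] by eventually_elim (use lam in \<open>auto simp: l_def\<close>)
  have "filterlim (\<lambda>t. (l t, \<xi>)) (at (lam, \<xi>) within {q. Re (fst q) > 0}) (at_right 0)"
    unfolding filterlim_at using ev by (auto intro!: tendsto_Pair l0 elim: eventually_mono)
  from filterlim_compose[OF lim this] have wl: "((\<lambda>t. w (l t, \<xi>)) \<longlongrightarrow> v) (at_right 0)" .
  have "((\<lambda>t. - l t * w (l t, \<xi>) $ 4 + \<i> * complex_of_real \<xi> * row_apply a (w (l t, \<xi>))) \<longlongrightarrow>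
      - lam * v $ 4 + \<i> * complex_of_real \<xi> * row_apply a v) (at_right 0)"
    unfolding row_apply_def by (intro tendsto_intros tendsto_vec_nth l0 wl)
  moreover have "- l t * w (l t, \<xi>) $ 4 + \<i> * complex_of_real \<xi> * row_apply a (w (l t, \<xi>)) = 0"
    if "Re (l t) > 0" for t
    using S[OF that w[OF that, of \<xi>]] speed_L[of "l t" \<xi> "w (l t, \<xi>)"] by simp
  then have "((\<lambda>t. - l t * w (l t, \<xi>) $ 4 + \<i> * complex_of_real \<xi> * row_apply a (w (l t, \<xi>)))
      \<longlongrightarrow> 0) (at_right 0)"
    by (intro tendsto_eventually eventually_mono[OF ev]) blast
  ultimately have "- lam * v $ 4 + \<i> * complex_of_real \<xi> * row_apply a v = 0"
    by (rule tendsto_unique[OF trivial_limit_at_right_real])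
  then show ?thesis
    using div_speed1_nonzero speed_L[of lam \<xi> v] by simp
qed

lemma L_E_plus:
  assumes "div_speed1 m V < 0" "Re lam \<ge> 0" "v \<in> E_plus m p V lam \<xi>"
  shows "LL lam \<xi> v = 0"
  using assms(3) unfolding E_plus_def
  by (intro L_extend[OF _ _ assms(2)])
    (use assms(1) in \<open>auto simp: stable_subspace_def Re_rate divide_less_0_iff zero_less_divide_iff intro!: L_span\<close>)

lemma L_E_minus:
  assumes "div_speed1 m V > 0" "Re lam \<ge> 0" "v \<in> E_minus m p V lam \<xi>"
  shows "LL lam \<xi> v = 0"
  using assms(3) unfolding E_minus_def
  by (intro L_extend[OF _ _ assms(2)])
    (use assms(1) in \<open>auto simp: unstable_subspace_def Re_rate divide_less_0_iff zero_less_divide_iff intro!: L_span\<close>)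

lemma L_tendsto:
  assumes "(f \<longlongrightarrow> v) F"
  shows "((\<lambda>x. LL lam \<xi> (f x)) \<longlongrightarrow> LL lam \<xi> v) F"
  unfolding row_apply_def by (intro tendsto_intros tendsto_vec_nth assms)

lemma L_vanishes_from_trace:
  assumes S: "open S" "convex S" "at 0 within S \<noteq> bot"
    and ode: "\<And>x. x \<in> S \<Longrightarrow> (f has_vector_derivative GG lam \<xi> *v f x) (at x)"
    and lim: "(f \<longlongrightarrow> v) (at 0 within S)" and v: "LL lam \<xi> v = 0" and "x \<in> S"
  shows "LL lam \<xi> (f x) = 0"
proof -
  let ?r = "rate lam \<xi>"
  define g where "g = (\<lambda>x. exp (complex_of_real x * - ?r) * LL lam \<xi> (f x))"
  have "bounded_linear (LL lam \<xi>)"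
    unfolding linear_conv_bounded_linear[symmetric]
    by (intro linearI)
      (simp_all add: scaleR_vec_def row_apply_def sum.distrib sum_distrib_left
        algebra_simps scaleR_conv_of_real)
  then have LLd: "((\<lambda>x. LL lam \<xi> (f x)) has_vector_derivative LL lam \<xi> (GG lam \<xi> *v f x)) (at x)"
    if "x \<in> S" for x
    using bounded_linear.has_vector_derivative ode that by blast
  have "(g has_vector_derivative 0) (at x)" if "x \<in> S" for x
    unfolding g_def
    using has_vector_derivative_mult[OF exp_scaleR_has_vector_derivative_right[of "- ?r" x UNIV] LLd[OF that]]
    by (simp add: scaleR_conv_of_real L_eigenvector algebra_simps)
  then obtain k where k: "\<And>x. x \<in> S \<Longrightarrow> g x = k"
    using has_vector_derivative_zero_constant[OF S(2), of g]
    by (blast intro: has_vector_derivative_at_within)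
  have "(g \<longlongrightarrow> exp (complex_of_real 0 * - ?r) * LL lam \<xi> v) (at 0 within S)"
    unfolding g_def by (intro tendsto_intros L_tendsto lim)
  then have "(g \<longlongrightarrow> 0) (at 0 within S)" by (simp add: v)
  moreover have "(g \<longlongrightarrow> k) (at 0 within S)"
    by (rule tendsto_eventually) (auto simp: eventually_at_filter k)
  ultimately have "k = 0"
    using S(3) tendsto_unique by blast
  with k[OF \<open>x \<in> S\<close>] show ?thesis
    by (simp add: g_def)
qed

end

lemma constraint_mode_iff_ker_L:
  assumes "normal_mode m p Vp Vm lam \<xi> V Y"
  shows "constraint_mode \<xi> V \<longleftrightarrow>
    (\<forall>x>0. V x \<in> ker_L m p Vp lam \<xi>) \<and> (\<forall>x<0. V x \<in> ker_L m p Vm lam \<xi>)"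
proof -
  have "vector_derivative V (at x) = G m p Vp lam \<xi> *v V x" if "x > 0" for x
    using assms that by (auto simp: normal_mode_def intro: vector_derivative_at)
  moreover have "vector_derivative V (at x) = G m p Vm lam \<xi> *v V x" if "x < 0" for x
    using assms that by (auto simp: normal_mode_def intro: vector_derivative_at)
  ultimately show ?thesis
    by (auto simp: constraint_mode_def ker_L_def L_def row_apply_vector_matrix
        linorder_neq_iff simp del: row_apply_Gamma)
qed

context
  fixes m :: mhd_model and p :: "real \<Rightarrow> real" and Vp Vm :: "real^5"
  assumes pp: "regular_state m p Vp" and pm: "regular_state m p Vm"
    and shock: "stationary_shock m p Vp Vm"
begin

lemma flux_jump: "flux1 m p Vp $ i = flux1 m p Vm $ i"
  using shock by (cases m) auto

lemma flux2_5: "flux2 m p V $ 5 = 0"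
  by (cases m) (simp_all add: beta_flux2_def)

lemma h1_jump: "Vp $ 4 = Vm $ 4"
proof (cases m)
  case (Beta_Model \<beta>)
  then show ?thesis
    using flux_jump[of 4] regular_state.div_speed1_nonzero[OF pp]
    by (simp add: beta_flux1_def h1_def)
qed (use shock in \<open>simp add: h1_def\<close>)

lemma div_speed1_sign: "div_speed1 m Vp > 0 \<longleftrightarrow> div_speed1 m Vm > 0"
proof (cases m)
  case Hybrid_Model
  then show ?thesis
    using flux_jump[of 1] shock
    by (simp add: beta_flux1_def u1_def rho_def zero_less_divide_iff)
qed simp

lemma speed_L_jump:
  assumes "linearized_jump m p Vp Vm lam \<xi> Y vp vm"
  shows "complex_of_real (div_speed1 m Vp) * row_apply (L m p Vp lam \<xi>) vp
    = complex_of_real (div_speed1 m Vm) * row_apply (L m p Vm lam \<xi>) vm"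
proof -
  let ?a = "\<lambda>V. row_apply (cvec (jacobian (flux1 m p) (at V) $ 5))"
  let ?i = "\<i> * complex_of_real \<xi>"
  have res5: "jump_residual m p Vp Vm lam \<xi> Y vp vm $ 5 = 0"
    using assms by (cases m) auto
  then have 5: "?a Vp vp - ?a Vm vm = Y * lam * complex_of_real (Vp $ 5 - Vm $ 5)"
    by (simp add: jump_residual_def flux2_5 cmat_mult_nth algebra_simps)
  have 4: "vp $ 4 - vm $ 4 = Y * ?i * complex_of_real (Vp $ 5 - Vm $ 5)"
  proof (cases m)
    case (Beta_Model \<beta>)
    have \<beta>: "\<beta> \<noteq> 0"
      using regular_state.div_speed1_nonzero[OF pp] by (simp add: Beta_Model)
    have row: "row_apply (cvec (jacobian (beta_flux1 \<beta> p) (at V) $ 4)) v = \<beta> * v $ 4"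
      if "regular_state m p V" for V v
    proof -
      have "jacobian (beta_flux1 \<beta> p) (at V) $ 4 = \<beta> *\<^sub>R Gamma1"
        using that by (intro jacobian_flux_rows) (auto simp: regular_state_def)
      then show ?thesis by (simp only: cvec_linear cvec_Gamma row_apply_linear row_apply_Gamma)
    qed
    have flux: "beta_flux2 \<beta> p V $ 4 = \<beta> * V $ 5 - beta_flux1 \<beta> p V $ 5" for V
      by (simp add: beta_flux1_def beta_flux2_def h2_def)
    have "jump_residual m p Vp Vm lam \<xi> Y vp vm $ 4 = 0"
      using assms by (simp add: Beta_Model)
    then have "\<beta> * (vp $ 4 - vm $ 4) = \<beta> * (Y * ?i * complex_of_real (Vp $ 5 - Vm $ 5))"
      using h1_jump flux_jump[of 5]
      by (simp add: jump_residual_def flux cmat_mult_nth row[OF pp] row[OF pm] Beta_Model algebra_simps)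
    then show ?thesis using \<beta> by simp
  qed (use assms in \<open>simp add: h2_def\<close>)
  have "- lam * (vp $ 4 - vm $ 4) + ?i * (?a Vp vp - ?a Vm vm) = 0"
    unfolding 4 5 by (simp add: algebra_simps)
  then show ?thesis
    unfolding regular_state.speed_L[OF pp] regular_state.speed_L[OF pm] by (simp add: algebra_simps)
qed

lemma normal_mode_constraint:
  assumes nm: "normal_mode m p Vp Vm lam \<xi> V Y" and lam: "Re lam \<ge> 0"
    and E: "\<forall>x>0. V x \<in> E_plus m p Vp lam \<xi>" "\<forall>x<0. V x \<in> E_minus m p Vm lam \<xi>"
  shows "constraint_mode \<xi> V"
proof -
  interpret P: regular_state m p Vp by (rule pp)
  interpret M: regular_state m p Vm by (rule pm)
  obtain vp vm where vp: "(V \<longlongrightarrow> vp) (at_right 0)" and vm: "(V \<longlongrightarrow> vm) (at_left 0)"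
    and jump: "linearized_jump m p Vp Vm lam \<xi> Y vp vm"
    using nm by (auto simp: normal_mode_def)
  have ode: "x > 0 \<Longrightarrow> (V has_vector_derivative G m p Vp lam \<xi> *v V x) (at x)"
    "x < 0 \<Longrightarrow> (V has_vector_derivative G m p Vm lam \<xi> *v V x) (at x)" for x
    using nm by (auto simp: normal_mode_def)
  have trace: "P.LL lam \<xi> vp = 0 \<longleftrightarrow> M.LL lam \<xi> vm = 0"
    using speed_L_jump[OF jump] P.div_speed1_nonzero M.div_speed1_nonzero
    by (metis mult_eq_0_iff of_real_eq_0_iff)
  have "P.LL lam \<xi> vp = 0 \<and> M.LL lam \<xi> vm = 0"
  proof (cases "div_speed1 m Vp > 0")
    case True
    then have "\<And>x. x < 0 \<Longrightarrow> M.LL lam \<xi> (V x) = 0"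
      using M.L_E_minus div_speed1_sign lam E(2) by blast
    then have "((\<lambda>x. M.LL lam \<xi> (V x)) \<longlongrightarrow> 0) (at_left 0)"
      by (intro tendsto_eventually) (auto simp: eventually_at_filter)
    with M.L_tendsto[OF vm] show ?thesis
      using tendsto_unique[OF trivial_limit_at_left_real] trace by blast
  next
    case False
    then have "\<And>x. x > 0 \<Longrightarrow> P.LL lam \<xi> (V x) = 0"
      using P.L_E_plus P.div_speed1_nonzero lam E(1) by (meson linorder_neqE)
    then have "((\<lambda>x. P.LL lam \<xi> (V x)) \<longlongrightarrow> 0) (at_right 0)"
      by (intro tendsto_eventually) (auto simp: eventually_at_filter)
    with P.L_tendsto[OF vp] show ?thesis
      using tendsto_unique[OF trivial_limit_at_right_real] trace by blast
  qed
  then have "x > 0 \<Longrightarrow> P.LL lam \<xi> (V x) = 0" "x < 0 \<Longrightarrow> M.LL lam \<xi> (V x) = 0" for x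
    using P.L_vanishes_from_trace[of "{0<..}" V lam \<xi> vp x]
      M.L_vanishes_from_trace[of "{..<0}" V lam \<xi> vm x] ode vp vm
    by (auto simp: trivial_limit_at_left_real trivial_limit_at_right_real)
  then show ?thesis
    by (auto simp: constraint_mode_iff_ker_L[OF nm] ker_L_def)
qed

end

theorem proposition2p27:
  fixes m :: mhd_model and p :: "real \<Rightarrow> real" and Vp Vm :: "real^5"
  assumes pressure: "\<And>r. r > 0 \<Longrightarrow> p differentiable (at r) \<and> deriv p r > 0"
    and model: "\<And>\<beta>. m = Beta_Model \<beta> \<Longrightarrow> \<beta> \<noteq> 0"
    and shock: "stationary_shock m p Vp Vm"
    and lax: "lax_type m p Vp Vm"
    and nonchar: "noncharacteristic m p Vp Vm"
    and right: "(h1 Vp)\<^sup>2 + (h2 Vp)\<^sup>2 \<noteq> rho Vp * deriv p (rho Vp)"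
    and left: "(h1 Vm)\<^sup>2 + (h2 Vm)\<^sup>2 \<noteq> rho Vm * deriv p (rho Vm)"
  shows "(stable_with_constraint m p Vp Vm \<longleftrightarrow> stable_without_constraint m p Vp Vm) \<and>
         (stable_without_constraint m p Vp Vm \<longleftrightarrow> stable_reduced m p Vp Vm)"
proof -
  have rho: "Vp $ 1 > 0" "Vm $ 1 > 0"
    using shock by (cases m; simp add: rho_def)+
  have reg: "regular_state m p Vp" "regular_state m p Vm"
    using nonchar rho pressure[OF rho(1)] pressure[OF rho(2)]
    by (auto simp: regular_state_def noncharacteristic_def)
  have "stable_with_constraint m p Vp Vm \<longleftrightarrow> stable_without_constraint m p Vp Vm"
    unfolding stable_with_constraint_def stable_without_constraint_def
    by (intro all_cong1 imp_cong refl arg_cong[where f = Not] ex_cong1)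
      (use normal_mode_constraint[OF reg shock] in auto)
  moreover have "stable_with_constraint m p Vp Vm \<longleftrightarrow> stable_reduced m p Vp Vm"
    unfolding stable_with_constraint_def stable_reduced_def E0_plus_def E0_minus_def
    by (intro all_cong1 imp_cong refl arg_cong[where f = Not] ex_cong1)
      (use constraint_mode_iff_ker_L in auto)
  ultimately show ?thesis by blast
qed

end
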